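(* The categories $\square^{\mathrm{op}}$ and $\mathcal{G}_c$ (defined in the context) are isomorphic via an isomorphism whose object part is the identity on $\mathbb{N}$. In particular, for all $m,n\in\mathbb{N}$ there is a bijection $\mathrm{Hom}_{\square^{\mathrm{op}}}(m,n)\simeq \mathrm{Hom}_{\mathcal{G}_c}(m,n)$, and these bijections are compatible with identities and composition.
   Context: For $n\in\mathbb{N}$ let $[n]=\{0,\dots,n-1\}$. For sets $A,B,C$, a function $f:A\to B+C$ (disjoint union) is injective on the left part if $f(x)=f(y)=b$ with $b\in B$ implies $x=y$. The category $\square$ has objects $\mathbb{N}$; a morphism $m\to n$ is a function $f:[m]\to [n]+\{0,1\}$ that is injective on the left part; the composite of $f:m\to n$ and $g:n\to p$ is $(g+\mathrm{id}_{\{0,1\}})\circ f$ (where $g+\mathrm{id}$ sends $j\in[n]$ to $g(j)$ and fixes $0,1$). $\square^{\mathrm{op}}$ is its opposite category. A graph is a pair $(V,E)$ with $E\subseteq V\times V$. A graph morphism $(V,E)\to(V',E')$ is a function $f:V\to V'$ such that $(s,t)\in E$ implies $(f(s),f(t))\in E'$. The standard $n$-cube graph $C_n$ has vertex set $\{0,1\}^{n}$ (binary sequences $x_0x_1\cdots x_{n-1}$) and edges: a loop $(v,v)$ at every vertex, and for each pair of vertices $u,v$ that differ in exactly one coordinate $i$ with $u_i=0$, $v_i=1$, an edge $(u,v)$. Let $C_n^*$ be the preorder on vertices with $u\le v$ iff there is a directed chain of edges from $u$ to $v$ (this is the coordinatewise order); its binary meet $u\wedge v$ and join $u\vee v$ are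 the coordinatewise minimum and maximum. A graph morphism $g:C_m\to C_n$ preserves meets (resp. joins) if $g(u\wedge v)=g(u)\wedge g(v)$ (resp. $g(u\vee v)=g(u)\vee g(v)$) for all vertices $u,v$. The category $\mathcal{G}_c$ has objects $\mathbb{N}$; a morphism $m\to n$ is a graph morphism $C_m\to C_n$ preserving binary meets and binary joins; composition is composition of functions. *)

theory Defs
  imports "HOL-Library.FuncSet" "HOL-Algebra.Lattice" "Graph_Theory.Pair_Digraph"
begin

section \<open>Categories, opposites, functors and isomorphisms\<close>

text \<open>
  Hom-sets are indexed by source and target and need not be disjoint: the same HOL value may
  represent morphisms between several pairs of objects. Composition and the morphism part of a
  functor therefore take the objects involved as arguments: \<open>Cmp C a b c g f\<close> is the composite
  of \<open>f : a \<rightarrow> b\<close> followed by \<open>g : b \<rightarrow> c\<close>.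
\<close>

record ('o, 'm) cat =
  Ob :: "'o set"
  Mor :: "'o \<Rightarrow> 'o \<Rightarrow> 'm set"
  Ident :: "'o \<Rightarrow> 'm"
  Cmp :: "'o \<Rightarrow> 'o \<Rightarrow> 'o \<Rightarrow> 'm \<Rightarrow> 'm \<Rightarrow> 'm"

locale category =
  fixes C :: "('o, 'm) cat"
  assumes ident_mor: "a \<in> Ob C \<Longrightarrow> Ident C a \<in> Mor C a a"
    and cmp_mor: "\<lbrakk>a \<in> Ob C; b \<in> Ob C; c \<in> Ob C; f \<in> Mor C a b; g \<in> Mor C b c\<rbrakk>
      \<Longrightarrow> Cmp C a b c g f \<in> Mor C a c"
    and cmp_ident_right: "\<lbrakk>a \<in> Ob C; b \<in> Ob C; f \<in> Mor C a b\<rbrakk>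
      \<Longrightarrow> Cmp C a a b f (Ident C a) = f"
    and cmp_ident_left: "\<lbrakk>a \<in> Ob C; b \<in> Ob C; f \<in> Mor C a b\<rbrakk>
      \<Longrightarrow> Cmp C a b b (Ident C b) f = f"
    and cmp_assoc: "\<lbrakk>a \<in> Ob C; b \<in> Ob C; c \<in> Ob C; d \<in> Ob C;
        f \<in> Mor C a b; g \<in> Mor C b c; h \<in> Mor C c d\<rbrakk>
      \<Longrightarrow> Cmp C a c d h (Cmp C a b c g f) = Cmp C a b d (Cmp C b c d h g) f"

definition opposite :: "('o, 'm) cat \<Rightarrow> ('o, 'm) cat" where
  "opposite C = \<lparr>Ob = Ob C, Mor = (\<lambda>a b. Mor C b a), Ident = Ident C,
     Cmp = (\<lambda>a b c g f. Cmp C c b a f g)\<rparr>"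

locale cat_functor = C: category C + D: category D
  for C :: "('o, 'm) cat" and D :: "('p, 'n) cat" +
  fixes Fo :: "'o \<Rightarrow> 'p" and Fm :: "'o \<Rightarrow> 'o \<Rightarrow> 'm \<Rightarrow> 'n"
  assumes fun_ob: "a \<in> Ob C \<Longrightarrow> Fo a \<in> Ob D"
    and fun_mor: "\<lbrakk>a \<in> Ob C; b \<in> Ob C; f \<in> Mor C a b\<rbrakk> \<Longrightarrow> Fm a b f \<in> Mor D (Fo a) (Fo b)"
    and fun_ident: "a \<in> Ob C \<Longrightarrow> Fm a a (Ident C a) = Ident D (Fo a)"
    and fun_cmp: "\<lbrakk>a \<in> Ob C; b \<in> Ob C; c \<in> Ob C; f \<in> Mor C a b; g \<in> Mor C b c\<rbrakk>
      \<Longrightarrow> Fm a c (Cmp C a b c g f) = Cmp D (Fo a) (Fo b) (Fo c) (Fm b c g) (Fm a b f)"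

definition inverse_functors ::
  "('o, 'm) cat \<Rightarrow> ('o \<Rightarrow> 'p) \<Rightarrow> ('o \<Rightarrow> 'o \<Rightarrow> 'm \<Rightarrow> 'n) \<Rightarrow> ('p \<Rightarrow> 'o) \<Rightarrow> ('p \<Rightarrow> 'p \<Rightarrow> 'n \<Rightarrow> 'm) \<Rightarrow> bool"
  \<comment> \<open>\<open>G \<circ> F\<close> is the identity functor of \<open>C\<close>\<close> where
  "inverse_functors C Fo Fm Go Gm \<longleftrightarrow>
     (\<forall>a\<in>Ob C. Go (Fo a) = a) \<and>
     (\<forall>a\<in>Ob C. \<forall>b\<in>Ob C. \<forall>f\<in>Mor C a b. Gm (Fo a) (Fo b) (Fm a b f) = f)"

definition cat_isomorphism ::
  "('o, 'm) cat \<Rightarrow> ('p, 'n) cat \<Rightarrow> ('o \<Rightarrow> 'p) \<Rightarrow> ('o \<Rightarrow> 'o \<Rightarrow> 'm \<Rightarrow> 'n) \<Rightarrow> bool" where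
  "cat_isomorphism C D Fo Fm \<longleftrightarrow> cat_functor C D Fo Fm \<and>
     (\<exists>Go Gm. cat_functor D C Go Gm \<and>
        inverse_functors C Fo Fm Go Gm \<and> inverse_functors D Go Gm Fo Fm)"


section \<open>The category \<open>\<box>\<close>\<close>

definition inj_on_left :: "('a \<Rightarrow> 'b + 'c) \<Rightarrow> 'a set \<Rightarrow> bool" where
  "inj_on_left f A \<longleftrightarrow> (\<forall>x\<in>A. \<forall>y\<in>A. \<forall>b. f x = Inl b \<and> f y = Inl b \<longrightarrow> x = y)"

text \<open>
  The two-element set \<open>{0,1}\<close> is rendered as \<open>bool\<close>, with \<open>False\<close> for 0 and \<open>True\<close> for 1.
  Functions on a set are represented by extensional functions, so that equality of morphisms
  is equality in HOL.
\<close>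

definition square_mor :: "nat \<Rightarrow> nat \<Rightarrow> (nat \<Rightarrow> nat + bool) set" where
  "square_mor m n = {f \<in> {..<m} \<rightarrow>\<^sub>E ({..<n} <+> (UNIV :: bool set)). inj_on_left f {..<m}}"

text \<open>The map \<open>case_sum g Inr\<close> is \<open>g + id\<close> followed by the identification of the two copies of
  \<open>{0,1}\<close>: it sends \<open>j\<close> to \<open>g j\<close> and fixes 0 and 1.\<close>

definition square_cat :: "(nat, nat \<Rightarrow> nat + bool) cat" where
  "square_cat = \<lparr>Ob = UNIV, Mor = square_mor, Ident = (\<lambda>n. restrict Inl {..<n}),
     Cmp = (\<lambda>m n p g f. compose {..<m} (case_sum g Inr) f)\<rparr>"


section \<open>Cube graphs and the category \<open>G\<^sub>c\<close>\<close>

definition graph_morphisms :: "'a pair_pre_digraph \<Rightarrow> 'b pair_pre_digraph \<Rightarrow> ('a \<Rightarrow> 'b) set" where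
  "graph_morphisms G H =
     {f \<in> pverts G \<rightarrow>\<^sub>E pverts H. \<forall>s t. (s, t) \<in> parcs G \<longrightarrow> (f s, f t) \<in> parcs H}"

definition cube_verts :: "nat \<Rightarrow> bool list set" where
  "cube_verts n = {x. length x = n}"

definition cube :: "nat \<Rightarrow> bool list pair_pre_digraph" where
  "cube n = \<lparr>pverts = cube_verts n,
     parcs = {(v, v) | v. v \<in> cube_verts n} \<union>
       {(u, v). u \<in> cube_verts n \<and> v \<in> cube_verts n \<and>
          (\<exists>i<n. u ! i = False \<and> v ! i = True \<and> (\<forall>j<n. j \<noteq> i \<longrightarrow> u ! j = v ! j))}\<rparr>"

definition cube_order :: "nat \<Rightarrow> bool list gorder" where
  "cube_order n = \<lparr>carrier = pverts (cube n), eq = (=), le = reachable (with_proj (cube n))\<rparr>"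

text \<open>Meets and joins are the order-theoretic ones of \<open>cube_order\<close>; they are shown below to be
  the coordinatewise minimum and maximum.\<close>

definition preserves_meets :: "nat \<Rightarrow> nat \<Rightarrow> (bool list \<Rightarrow> bool list) \<Rightarrow> bool" where
  "preserves_meets m n g \<longleftrightarrow> (\<forall>u\<in>pverts (cube m). \<forall>v\<in>pverts (cube m).
     g (u \<sqinter>\<^bsub>cube_order m\<^esub> v) = g u \<sqinter>\<^bsub>cube_order n\<^esub> g v)"

definition preserves_joins :: "nat \<Rightarrow> nat \<Rightarrow> (bool list \<Rightarrow> bool list) \<Rightarrow> bool" where
  "preserves_joins m n g \<longleftrightarrow> (\<forall>u\<in>pverts (cube m). \<forall>v\<in>pverts (cube m).
     g (u \<squnion>\<^bsub>cube_order m\<^esub> v) = g u \<squnion>\<^bsub>cube_order n\<^esub> g v)"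

definition cube_mor :: "nat \<Rightarrow> nat \<Rightarrow> (bool list \<Rightarrow> bool list) set" where
  "cube_mor m n =
     {g \<in> graph_morphisms (cube m) (cube n). preserves_meets m n g \<and> preserves_joins m n g}"

definition cube_cat :: "(nat, bool list \<Rightarrow> bool list) cat" where
  "cube_cat = \<lparr>Ob = UNIV, Mor = cube_mor, Ident = (\<lambda>n. restrict id (pverts (cube n))),
     Cmp = (\<lambda>m n p g f. compose (pverts (cube m)) g f)\<rparr>"


subsection \<open>The order on the cube is coordinatewise\<close>

lemma pair_wf_digraph_cube: "pair_wf_digraph (cube n)"
  by unfold_locales (auto simp: cube_def)

lemma cube_order_iff:
  "u \<sqsubseteq>\<^bsub>cube_order n\<^esub> v \<longleftrightarrow>
     length u = n \<and> length v = n \<and> (\<forall>i<n. u ! i \<le> v ! i)" (is "_ \<longleftrightarrow> ?R")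
proof
  assume "u \<sqsubseteq>\<^bsub>cube_order n\<^esub> v"
  then have "(u, v) \<in> rtrancl_on (cube_verts n) (parcs (cube n))"
    by (simp add: cube_order_def reachable_def cube_def)
  then show ?R
  proof (induct rule: rtrancl_on_induct)
    case base
    then show ?case by (simp add: cube_verts_def)
  next
    case (step y z)
    then have "\<forall>i<n. y ! i \<le> z ! i"
      by (auto simp: cube_def)
    with step show ?case
      by (auto simp: cube_verts_def)
  qed
next
  assume R: ?R
  have *: "(u, take k v @ drop k u) \<in> rtrancl_on (cube_verts n) (parcs (cube n))"
    if "k \<le> n" for k
    using that
  proof (induct k)
    case 0
    then show ?case using R by (simp add: cube_verts_def)
  next
    case (Suc k)
    let ?x = "take k v @ drop k u" and ?y = "take (Suc k) v @ drop (Suc k) u"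
    have len: "length ?x = n" "length ?y = n" using R Suc.prems by auto
    have nth: "j < n \<Longrightarrow> ?x ! j = (if j < k then v ! j else u ! j)"
      "j < n \<Longrightarrow> ?y ! j = (if j < Suc k then v ! j else u ! j)" for j
      using R Suc.prems by (auto simp: nth_append)
    have "(?x, ?y) \<in> parcs (cube n)"
    proof (cases "u ! k = v ! k")
      case True
      have "?x = ?y"
        using len nth True by (intro nth_equalityI) (auto simp: less_Suc_eq)
      then show ?thesis using len by (simp add: cube_def cube_verts_def)
    next
      case False
      then have "\<not> u ! k" "v ! k" using R Suc.prems by auto
      then have "?x ! k = False \<and> ?y ! k = True \<and> (\<forall>j<n. j \<noteq> k \<longrightarrow> ?x ! j = ?y ! j)"
        using nth Suc.prems by (auto simp: less_Suc_eq)
      moreover have "k < n" using Suc.prems by simp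
      ultimately show ?thesis using len unfolding cube_def cube_verts_def by auto
    qed
    moreover have "?y \<in> cube_verts n" using len by (simp add: cube_verts_def)
    ultimately show ?case
      using Suc by (meson Suc_leD rtrancl_on_into_rtrancl_on)
  qed
  from *[of n] R show "u \<sqsubseteq>\<^bsub>cube_order n\<^esub> v"
    by (simp add: cube_order_def reachable_def cube_def)
qed

lemma carrier_cube_order: "carrier (cube_order n) = cube_verts n"
  by (simp add: cube_order_def cube_def)

lemma cube_order_refl: "x \<in> cube_verts n \<Longrightarrow> x \<sqsubseteq>\<^bsub>cube_order n\<^esub> x"
  by (simp add: cube_order_iff cube_verts_def)

lemma cube_order_antisym:
  "x \<sqsubseteq>\<^bsub>cube_order n\<^esub> y \<Longrightarrow> y \<sqsubseteq>\<^bsub>cube_order n\<^esub> x \<Longrightarrow> x = y"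
  unfolding cube_order_iff by (metis nth_equalityI order_antisym)

lemma cube_order_trans:
  "x \<sqsubseteq>\<^bsub>cube_order n\<^esub> y \<Longrightarrow> y \<sqsubseteq>\<^bsub>cube_order n\<^esub> z \<Longrightarrow> x \<sqsubseteq>\<^bsub>cube_order n\<^esub> z"
  unfolding cube_order_iff by (meson order_trans)

lemma partial_order_cube_order: "partial_order (cube_order n)"
proof -
  have eq: "(.=\<^bsub>cube_order n\<^esub>) = (=)"
    by (simp add: cube_order_def)
  show ?thesis
  proof (unfold_locales, unfold eq)
    fix x y z w :: "bool list"
    show "x \<in> carrier (cube_order n) \<Longrightarrow> x \<sqsubseteq>\<^bsub>cube_order n\<^esub> x"
      by (simp add: carrier_cube_order cube_order_refl)
    show "x \<sqsubseteq>\<^bsub>cube_order n\<^esub> y \<Longrightarrow> y \<sqsubseteq>\<^bsub>cube_order n\<^esub> x \<Longrightarrow> x = y"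
      by (rule cube_order_antisym)
    show "x \<sqsubseteq>\<^bsub>cube_order n\<^esub> y \<Longrightarrow> y \<sqsubseteq>\<^bsub>cube_order n\<^esub> z \<Longrightarrow> x \<sqsubseteq>\<^bsub>cube_order n\<^esub> z"
      by (rule cube_order_trans)
  qed simp_all
qed

lemma cube_meet:
  assumes "u \<in> pverts (cube n)" "v \<in> pverts (cube n)"
  shows "u \<sqinter>\<^bsub>cube_order n\<^esub> v = map2 min u v"
proof -
  interpret partial_order "cube_order n" by (rule partial_order_cube_order)
  have len: "length u = n" "length v = n"
    using assms by (simp_all add: cube_def cube_verts_def)
  have "map2 min u v \<in> Lower (cube_order n) {u, v}"
    using len by (auto simp: Lower_def carrier_cube_order cube_order_iff cube_verts_def min_def max_def)
  moreover have "w \<sqsubseteq>\<^bsub>cube_order n\<^esub> map2 min u v" if "w \<in> Lower (cube_order n) {u, v}" for w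
  proof -
    have "w \<sqsubseteq>\<^bsub>cube_order n\<^esub> u" "w \<sqsubseteq>\<^bsub>cube_order n\<^esub> v"
      using that len by (auto simp: Lower_def carrier_cube_order cube_verts_def)
    then show ?thesis
      by (auto simp: cube_order_iff min_def max_def)
  qed
  ultimately have "is_glb (cube_order n) (map2 min u v) {u, v}"
    by (simp add: greatest_def)
  then show ?thesis
    unfolding meet_def inf_def by (metis (mono_tags, lifting) greatest_unique someI)
qed

lemma cube_join:
  assumes "u \<in> pverts (cube n)" "v \<in> pverts (cube n)"
  shows "u \<squnion>\<^bsub>cube_order n\<^esub> v = map2 max u v"
proof -
  interpret partial_order "cube_order n" by (rule partial_order_cube_order)
  have len: "length u = n" "length v = n"
    using assms by (simp_all add: cube_def cube_verts_def)
  have "map2 max u v \<in> Upper (cube_order n) {u, v}"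
    using len by (auto simp: Upper_def carrier_cube_order cube_order_iff cube_verts_def min_def max_def)
  moreover have "map2 max u v \<sqsubseteq>\<^bsub>cube_order n\<^esub> w" if "w \<in> Upper (cube_order n) {u, v}" for w
  proof -
    have "u \<sqsubseteq>\<^bsub>cube_order n\<^esub> w" "v \<sqsubseteq>\<^bsub>cube_order n\<^esub> w"
      using that len by (auto simp: Upper_def carrier_cube_order cube_verts_def)
    then show ?thesis
      by (auto simp: cube_order_iff min_def max_def)
  qed
  ultimately have "is_lub (cube_order n) (map2 max u v) {u, v}"
    by (simp add: least_def)
  then show ?thesis
    unfolding join_def sup_def by (metis (mono_tags, lifting) least_unique someI)
qed

end

theory Submission
  imports Defs
begin

text \<open>
  A map \<open>f : [n] \<rightarrow> [m] + {0,1}\<close> acts on cubes by reading off, as the \<open>i\<close>-th coordinate of the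
  image of \<open>x\<close>, either the coordinate of \<open>x\<close> named by \<open>f i\<close> or the constant \<open>f i\<close>; injectivity on
  the left part says exactly that flipping one input bit flips at most one output bit. Conversely,
  each coordinate \<open>h\<close> of a cube morphism is a lattice homomorphism \<open>{0,1}\<^sup>m \<rightarrow> {0,1}\<close>. If
  \<open>h\<close> is not constant, then along the chain \<open>t\<^sub>k = 1\<dots>10\<dots>0\<close> (with \<open>k\<close> ones) it jumps from 0 to 1
  between some \<open>t\<^sub>k\<close> and \<open>t\<^sub>k\<^sub>+\<^sub>1\<close>. If \<open>x\<^sub>k = 1\<close>, then \<open>t\<^sub>k\<^sub>+\<^sub>1 \<le> t\<^sub>k \<or> x\<close> forces \<open>h x = 1\<close>; if \<open>x\<^sub>k = 0\<close>,
  then \<open>t\<^sub>k\<^sub>+\<^sub>1 \<and> x \<le> t\<^sub>k\<close> forces \<open>h x = 0\<close>. So \<open>h\<close> is the projection to coordinate \<open>k\<close>.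
\<close>

subsection \<open>Categories and isomorphisms\<close>

lemma category_opposite:
  assumes "category C"
  shows "category (opposite C)"
proof -
  interpret category C by (rule assms)
  show ?thesis
    by unfold_locales
      (simp_all add: opposite_def ident_mor cmp_mor cmp_ident_left cmp_ident_right cmp_assoc)
qed

text \<open>The inverse functor is the inverse bijection on each hom-set; its functor laws come from
  those of \<open>F\<close> by cancelling \<open>F\<close>.\<close>

lemma cat_isomorphism_identity_on_objects:
  assumes F: "cat_functor C D (\<lambda>a. a) F"
    and Ob: "Ob D = Ob C"
    and bij: "\<And>a b. \<lbrakk>a \<in> Ob C; b \<in> Ob C\<rbrakk> \<Longrightarrow> bij_betw (F a b) (Mor C a b) (Mor D a b)"
  shows "cat_isomorphism C D (\<lambda>a. a) F"
proof -
  interpret F: cat_functor C D "\<lambda>a. a" F by (rule F)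
  define G where "G a b = inv_into (Mor C a b) (F a b)" for a b
  have GF: "G a b (F a b f) = f" if "a \<in> Ob C" "b \<in> Ob C" "f \<in> Mor C a b" for a b f
    using bij[OF that(1,2)] that(3) by (simp add: G_def bij_betw_inv_into_left)
  have FG: "F a b (G a b g) = g" if "a \<in> Ob C" "b \<in> Ob C" "g \<in> Mor D a b" for a b g
    using bij[OF that(1,2)] that(3) by (simp add: G_def bij_betw_inv_into_right)
  have G_mor: "G a b g \<in> Mor C a b" if "a \<in> Ob C" "b \<in> Ob C" "g \<in> Mor D a b" for a b g
    using bij[OF that(1,2)] that(3) by (metis G_def bij_betw_imp_surj_on inv_into_into)
  have "cat_functor D C (\<lambda>a. a) G"
  proof (unfold_locales, unfold Ob)
    fix a assume "a \<in> Ob C"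
    then show "G a a (Ident D a) = Ident C a"
      by (metis F.C.ident_mor F.fun_ident GF)
  next
    fix a b c f g
    assume *: "a \<in> Ob C" "b \<in> Ob C" "c \<in> Ob C" "f \<in> Mor D a b" "g \<in> Mor D b c"
    have "F a c (Cmp C a b c (G b c g) (G a b f)) = Cmp D a b c g f"
      using * by (simp add: F.fun_cmp G_mor FG)
    then show "G a c (Cmp D a b c g f) = Cmp C a b c (G b c g) (G a b f)"
      using * by (metis F.C.cmp_mor GF G_mor)
  qed (simp_all add: G_mor)
  moreover have "inverse_functors C (\<lambda>a. a) F (\<lambda>a. a) G"
    by (simp add: inverse_functors_def GF)
  moreover have "inverse_functors D (\<lambda>a. a) G (\<lambda>a. a) F"
    by (simp add: inverse_functors_def FG Ob)
  ultimately show ?thesis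
    using F unfolding cat_isomorphism_def by blast
qed

section \<open>The category of left-injective functions\<close>

lemma square_mor_cases:
  assumes "f \<in> square_mor m n" "i < m"
  obtains (coord) k where "f i = Inl k" "k < n" | (const) b where "f i = Inr b"
proof -
  have "f i \<in> {..<n} <+> UNIV"
    using assms by (auto simp: square_mor_def)
  then show ?thesis
    by (elim PlusE) (auto intro: that)
qed

lemma square_mor_inj:
  assumes "f \<in> square_mor m n" "i < m" "j < m" "f i = Inl k" "f j = Inl k"
  shows "i = j"
  using assms by (auto simp: square_mor_def inj_on_left_def)

lemma square_mor_extensional: "f \<in> square_mor m n \<Longrightarrow> f \<in> extensional {..<m}"
  by (auto simp: square_mor_def PiE_def)

text \<open>A left value of the composite passes through a left value of \<open>f\<close>, because
  constants stay constants. Injectivity of \<open>g\<close> and then of \<open>f\<close> recovers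
  the index.\<close>

lemma square_mor_compose:
  assumes f: "f \<in> square_mor m n" and g: "g \<in> square_mor n p"
  shows "compose {..<m} (case_sum g Inr) f \<in> square_mor m p"
proof -
  have "case_sum g Inr (f i) \<in> {..<p} <+> UNIV" if "i < m" for i
    using f that
  proof (cases rule: square_mor_cases)
    case (coord k)
    from g coord(2) show ?thesis
      by (cases rule: square_mor_cases) (auto simp: coord)
  qed auto
  moreover have "i = j"
    if ij: "i < m" "j < m" "case_sum g Inr (f i) = Inl b" "case_sum g Inr (f j) = Inl b" for i j b
  proof -
    obtain k where k: "f i = Inl k" "k < n" "g k = Inl b"
      using f ij(1,3) by (cases rule: square_mor_cases) auto
    obtain l where l: "f j = Inl l" "l < n" "g l = Inl b"
      using f ij(2,4) by (cases rule: square_mor_cases) auto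
    have "k = l"
      using g k l by (blast intro: square_mor_inj)
    then show ?thesis
      using f ij k l by (blast intro: square_mor_inj)
  qed
  ultimately show ?thesis
    by (auto simp: square_mor_def inj_on_left_def compose_def)
qed

lemma category_square: "category square_cat"
proof (unfold_locales, simp_all add: square_cat_def)
  show "restrict Inl {..<n} \<in> square_mor n n" for n
    by (auto simp: square_mor_def inj_on_left_def)
next
  fix m n p f g
  assume "f \<in> square_mor m n" "g \<in> square_mor n p"
  then show "compose {..<m} (case_sum g Inr) f \<in> square_mor m p"
    by (rule square_mor_compose)
next
  fix m n f
  assume f: "f \<in> square_mor m n"
  show "compose {..<m} (case_sum f Inr) (restrict Inl {..<m}) = f"
    using square_mor_extensional[OF f]
    by (auto simp: compose_def extensional_def fun_eq_iff)
  \<comment> \<open>\<open>restrict Inl {..<n}\<close> agrees with \<open>Inl\<close> only below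
    \<open>n\<close>, so the bound on the left values of \<open>f\<close> enters here.\<close>
  show "compose {..<m} (case_sum (restrict Inl {..<n}) Inr) f = f"
  proof
    fix i
    show "compose {..<m} (case_sum (restrict Inl {..<n}) Inr) f i = f i"
    proof (cases "i < m")
      case True
      with f show ?thesis
        by (cases rule: square_mor_cases) (simp_all add: compose_def True)
    next
      case False
      then show ?thesis
        using square_mor_extensional[OF f] by (simp add: compose_def extensional_def)
    qed
  qed
next
  fix m n p q f g h
  assume f: "f \<in> square_mor m n"
  show "compose {..<m} (case_sum h Inr) (compose {..<m} (case_sum g Inr) f) =
      compose {..<m} (case_sum (compose {..<n} (case_sum h Inr) g) Inr) f"
  proof
    fix i
    show "compose {..<m} (case_sum h Inr) (compose {..<m} (case_sum g Inr) f) i =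
      compose {..<m} (case_sum (compose {..<n} (case_sum h Inr) g) Inr) f i"
    proof (cases "i < m")
      case True
      with f show ?thesis
        by (cases rule: square_mor_cases) (simp_all add: compose_def True)
    qed (simp add: compose_def)
  qed
qed

subsection \<open>Cube morphisms\<close>

lemma pverts_cube: "pverts (cube n) = cube_verts n"
  by (simp add: cube_def)

text \<open>With the target of an arc written as a list update, arguments about arcs become
  equations between lists.\<close>

lemma parcs_cube_iff:
  "(u, v) \<in> parcs (cube n) \<longleftrightarrow>
     u \<in> cube_verts n \<and> (v = u \<or> (\<exists>i<n. \<not> u ! i \<and> v = u[i := True]))"
proof -
  have "length v = n \<and> \<not> u ! i \<and> v ! i \<and> (\<forall>j<n. j \<noteq> i \<longrightarrow> u ! j = v ! j)
      \<longleftrightarrow> \<not> u ! i \<and> v = u[i := True]" if "length u = n" "i < n" for i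
    using that by (auto simp: list_eq_iff_nth_eq nth_list_update)
  then show ?thesis
    by (auto simp: cube_def cube_verts_def)
qed

text \<open>By \<open>cube_meet\<close> and \<open>cube_join\<close> the order-theoretic operations
  become coordinatewise ones; on the target side this applies because \<open>g\<close> maps vertices
  to vertices.\<close>

lemma cube_mor_iff:
  "g \<in> cube_mor m n \<longleftrightarrow>
     g \<in> cube_verts m \<rightarrow>\<^sub>E cube_verts n \<and>
     (\<forall>u v. (u, v) \<in> parcs (cube m) \<longrightarrow> (g u, g v) \<in> parcs (cube n)) \<and>
     (\<forall>u\<in>cube_verts m. \<forall>v\<in>cube_verts m. g (map2 min u v) = map2 min (g u) (g v)) \<and>
     (\<forall>u\<in>cube_verts m. \<forall>v\<in>cube_verts m. g (map2 max u v) = map2 max (g u) (g v))"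
proof (cases "g \<in> cube_verts m \<rightarrow>\<^sub>E cube_verts n")
  case True
  then have "g u \<in> cube_verts n" if "u \<in> cube_verts m" for u
    using that by (rule PiE_mem)
  with True show ?thesis
    by (simp add: cube_mor_def graph_morphisms_def preserves_meets_def preserves_joins_def
        pverts_cube cube_meet cube_join conj_assoc)
qed (simp add: cube_mor_def graph_morphisms_def pverts_cube)

lemma map2_cube_verts: "u \<in> cube_verts n \<Longrightarrow> v \<in> cube_verts n \<Longrightarrow> map2 f u v \<in> cube_verts n"
  by (simp add: cube_verts_def)

lemma cube_mor_compose:
  assumes f: "f \<in> cube_mor m n" and g: "g \<in> cube_mor n p"
  shows "compose (cube_verts m) g f \<in> cube_mor m p"
proof -
  have fv: "f u \<in> cube_verts n" if "u \<in> cube_verts m" for u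
    using f that by (auto simp: cube_mor_iff)
  have gv: "g u \<in> cube_verts p" if "u \<in> cube_verts n" for u
    using g that by (auto simp: cube_mor_iff)
  have "u \<in> cube_verts m" "v \<in> cube_verts m" if "(u, v) \<in> parcs (cube m)" for u v
    using that by (auto simp: parcs_cube_iff cube_verts_def)
  then show ?thesis
    using f g fv gv map2_cube_verts[of _ m _ min] map2_cube_verts[of _ m _ max]
    unfolding cube_mor_iff by (simp add: compose_def)
qed

lemma category_cube: "category cube_cat"
proof (unfold_locales, simp_all add: cube_cat_def pverts_cube)
  show "restrict id (cube_verts n) \<in> cube_mor n n" for n
    by (auto simp: cube_mor_iff map2_cube_verts parcs_cube_iff cube_verts_def)
next
  fix m n p f g
  assume "f \<in> cube_mor m n" "g \<in> cube_mor n p"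
  then show "compose (cube_verts m) g f \<in> cube_mor m p"
    by (rule cube_mor_compose)
next
  fix m n f
  assume "f \<in> cube_mor m n"
  then have f: "f \<in> cube_verts m \<rightarrow>\<^sub>E cube_verts n"
    by (simp add: cube_mor_iff)
  show "compose (cube_verts m) f (restrict id (cube_verts m)) = f"
    using f by (intro extensionalityI[of _ "cube_verts m"]) (auto simp: compose_def PiE_def)
  show "compose (cube_verts m) (restrict id (cube_verts n)) f = f"
    using f by (intro extensionalityI[of _ "cube_verts m"]) (auto simp: compose_def PiE_def)
next
  fix m n p q f g h
  assume "f \<in> cube_mor m n"
  then have "f \<in> cube_verts m \<rightarrow> cube_verts n"
    by (auto simp: cube_mor_iff)
  then show "compose (cube_verts m) h (compose (cube_verts m) g f) =
      compose (cube_verts m) (compose (cube_verts n) h g) f"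
    by (rule compose_assoc)
qed

section \<open>Lattice homomorphisms from a cube to the two-element lattice\<close>

lemma cube_hom_projection_or_constant:
  fixes h :: "bool list \<Rightarrow> bool"
  assumes meet: "\<And>u v. \<lbrakk>u \<in> cube_verts m; v \<in> cube_verts m\<rbrakk> \<Longrightarrow> h (map2 min u v) = min (h u) (h v)"
    and join: "\<And>u v. \<lbrakk>u \<in> cube_verts m; v \<in> cube_verts m\<rbrakk> \<Longrightarrow> h (map2 max u v) = max (h u) (h v)"
  shows "(\<exists>k<m. \<forall>x\<in>cube_verts m. h x = x ! k) \<or> (\<exists>b. \<forall>x\<in>cube_verts m. h x = b)"
proof -
  have mono: "h u \<le> h v"
    if "u \<in> cube_verts m" "v \<in> cube_verts m" "\<And>i. i < m \<Longrightarrow> u ! i \<le> v ! i" for u v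
  proof -
    \<comment> \<open>The join of comparable vertices is the larger one, so join preservation yields
      monotonicity.\<close>
    have "map2 max u v = v"
      using that by (auto simp: list_eq_iff_nth_eq cube_verts_def max_def)
    then show ?thesis
      using join[OF that(1,2)] by (auto simp: max_def split: if_splits)
  qed
  define t where "t k = map (\<lambda>i. i < k) [0..<m]" for k
  have t: "t k \<in> cube_verts m" for k
    by (simp add: t_def cube_verts_def)
  have t_nth: "t k ! i \<longleftrightarrow> i < k" if "i < m" for k i
    using that by (simp add: t_def)
  \<comment> \<open>\<open>t 0\<close> and \<open>t m\<close> are the least and the greatest vertex,
    so equal values there make \<open>h\<close> constant.\<close>
  have bounds: "h (t 0) \<le> h x" "h x \<le> h (t m)" if "x \<in> cube_verts m" for x
    by (rule mono; simp add: t that t_nth)+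
  show ?thesis
  proof (cases "h (t 0) = h (t m)")
    case True
    then have "h x = h (t 0)" if "x \<in> cube_verts m" for x
      using bounds[OF that] by (intro order_antisym) simp_all
    then show ?thesis by blast
  next
    case False
    with bounds(1)[OF t[of m]] have "\<not> h (t 0)" "h (t m)"
      by auto
    then obtain k where k: "k < m" "\<not> h (t k)" "h (t (Suc k))"
      using ex_least_nat_less[of "\<lambda>k. h (t k)" m] by blast
    have "h x = x ! k" if x: "x \<in> cube_verts m" for x
    proof (cases "x ! k")
      case True
      have "h (t (Suc k)) \<le> h (map2 max (t k) x)"
        using x True t[of k] by (intro mono t map2_cube_verts)
          (auto simp: t_nth cube_verts_def less_Suc_eq max_def)
      then show ?thesis
        using True k join[OF t x] by (simp add: max_def split: if_splits)
    next
      case False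
      have "h (map2 min (t (Suc k)) x) \<le> h (t k)"
        using x False t[of "Suc k"] by (intro mono t map2_cube_verts)
          (auto simp: t_nth cube_verts_def less_Suc_eq min_def)
      then show ?thesis
        using False k meet[OF t x] by (simp add: min_def split: if_splits)
    qed
    with k(1) show ?thesis by blast
  qed
qed

subsection \<open>The action of \<open>\<box>\<close> on cubes\<close>

text \<open>A vertex \<open>x\<close> of the \<open>m\<close>-cube amounts to a morphism from
  \<open>m\<close> to \<open>0\<close> in \<open>square_cat\<close>; this is its extension by the
  identity on constants.\<close>

definition entry :: "bool list \<Rightarrow> nat + bool \<Rightarrow> bool" where
  "entry x = case_sum (\<lambda>k. x ! k) (\<lambda>b. b)"

lemma entry_simps [simp]: "entry x (Inl k) = x ! k" "entry x (Inr b) = b"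
  by (simp_all add: entry_def)

text \<open>The vertex with a single 1 at \<open>i\<close> separates projection \<open>i\<close>
  from every other projection; the vertex with all bits \<open>\<not> c\<close> separates any
  projection from the constant \<open>c\<close>.\<close>

lemma entry_inject:
  assumes "a \<in> {..<m} <+> UNIV" "b \<in> {..<m} <+> UNIV"
    and eq: "\<And>x. x \<in> cube_verts m \<Longrightarrow> entry x a = entry x b"
  shows "a = b"
proof -
  have unit: "entry ((replicate m False)[k := True]) a = entry ((replicate m False)[k := True]) b"
    and const: "entry (replicate m c) a = entry (replicate m c) b" for k c
    by (rule eq, simp add: cube_verts_def)+
  show ?thesis
  proof (cases a; cases b)
    fix i j assume *: "a = Inl i" "b = Inl j"
    then show ?thesis
      using assms(1,2) unit[of i] by (auto simp: nth_list_update split: if_splits)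
  next
    fix i c assume "a = Inl i" "b = Inr c"
    then show ?thesis
      using assms(1) const[of "\<not> c"] by auto
  next
    fix c j assume "a = Inr c" "b = Inl j"
    then show ?thesis
      using assms(2) const[of "\<not> c"] by auto
  next
    fix c d assume "a = Inr c" "b = Inr d"
    then show ?thesis
      using const[of c] by simp
  qed
qed

text \<open>With vertices read as morphisms to \<open>0\<close>, this is precomposition with
  \<open>f\<close>. Hence the reversal: \<open>f\<close> goes from \<open>n\<close> to
  \<open>m\<close>, its action from the \<open>m\<close>-cube to the \<open>n\<close>-cube.\<close>

definition cube_map :: "nat \<Rightarrow> nat \<Rightarrow> (nat \<Rightarrow> nat + bool) \<Rightarrow> bool list \<Rightarrow> bool list" where
  "cube_map m n f = (\<lambda>x\<in>cube_verts m. map (\<lambda>i. entry x (f i)) [0..<n])"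

lemma cube_map_verts: "x \<in> cube_verts m \<Longrightarrow> cube_map m n f x \<in> cube_verts n"
  by (simp add: cube_map_def cube_verts_def)

lemma cube_map_nth:
  "x \<in> cube_verts m \<Longrightarrow> i < n \<Longrightarrow> cube_map m n f x ! i = entry x (f i)"
  by (simp add: cube_map_def)

lemma cube_map_extensional: "cube_map m n f \<in> extensional (cube_verts m)"
  by (simp add: cube_map_def)

lemma cube_verts_eqI:
  "\<lbrakk>x \<in> cube_verts n; y \<in> cube_verts n; \<And>i. i < n \<Longrightarrow> x ! i = y ! i\<rbrakk> \<Longrightarrow> x = y"
  by (simp add: cube_verts_def nth_equalityI)

text \<open>A projection commutes with any coordinatewise operation, a constant with an idempotent
  one. The general \<open>op\<close> treats \<open>min\<close> and \<open>max\<close> at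
  once.\<close>

lemma entry_map2:
  assumes f: "f \<in> square_mor n m" and "i < n" "u \<in> cube_verts m" "v \<in> cube_verts m"
    and idem: "\<And>b. op b b = b"
  shows "entry (map2 op u v) (f i) = op (entry u (f i)) (entry v (f i))"
  using f \<open>i < n\<close> by (cases rule: square_mor_cases) (use assms in \<open>auto simp: cube_verts_def\<close>)

lemma cube_map_map2:
  assumes f: "f \<in> square_mor n m" and u: "u \<in> cube_verts m" and v: "v \<in> cube_verts m"
    and idem: "\<And>b. op b b = b"
  shows "cube_map m n f (map2 op u v) = map2 op (cube_map m n f u) (cube_map m n f v)"
proof (rule cube_verts_eqI)
  fix i assume i: "i < n"
  have "length (cube_map m n f u) = n" "length (cube_map m n f v) = n"
    using cube_map_verts u v by (simp_all add: cube_verts_def)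
  then show "cube_map m n f (map2 op u v) ! i = map2 op (cube_map m n f u) (cube_map m n f v) ! i"
    using i u v entry_map2[where op = op, OF f i u v idem] by (simp add: cube_map_nth map2_cube_verts)
qed (intro cube_map_verts map2_cube_verts u v)+

text \<open>Setting bit \<open>k\<close> affects only the output coordinates that read
  \<open>k\<close>, and left injectivity leaves at most one of these.\<close>

lemma cube_map_arc:
  assumes f: "f \<in> square_mor n m" and arc: "(u, v) \<in> parcs (cube m)"
  shows "(cube_map m n f u, cube_map m n f v) \<in> parcs (cube n)"
proof -
  have u: "u \<in> cube_verts m" and
    v: "v = u \<or> (\<exists>k<m. \<not> u ! k \<and> v = u[k := True])"
    using arc by (auto simp: parcs_cube_iff)
  note fu = cube_map_verts[OF u, of n f]
  from v show ?thesis
  proof (elim disjE exE conjE)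
    assume "v = u"
    with fu show ?thesis by (simp add: parcs_cube_iff)
  next
    fix k assume k: "k < m" "\<not> u ! k" "v = u[k := True]"
    then have v: "v \<in> cube_verts m"
      using u by (simp add: cube_verts_def)
    have entry_v: "entry v (f i) = (if f i = Inl k then True else entry u (f i))" if "i < n" for i
      using u k by (cases "f i") (auto simp: cube_verts_def nth_list_update)
    show ?thesis
    proof (cases "\<exists>i<n. f i = Inl k")
      case True
      then obtain i where i: "i < n" "f i = Inl k" by blast
      have "f j \<noteq> Inl k" if "j < n" "j \<noteq> i" for j
        using square_mor_inj[OF f] i that by blast
      then have "cube_map m n f v = (cube_map m n f u)[i := True]"
        using fu u v i entry_v
        by (intro cube_verts_eqI[of _ n] cube_map_verts)
          (auto simp: cube_verts_def cube_map_nth nth_list_update)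
      moreover have "\<not> cube_map m n f u ! i"
        using u i k by (simp add: cube_map_nth)
      ultimately show ?thesis
        using fu i by (auto simp: parcs_cube_iff)
    next
      \<comment> \<open>No output coordinate reads bit \<open>k\<close>, so the arc collapses to a
        loop, which the cube graph contains.\<close>
      case False
      then have "cube_map m n f v = cube_map m n f u"
        using u v entry_v by (intro cube_verts_eqI[of _ n] cube_map_verts) (auto simp: cube_map_nth)
      with fu show ?thesis by (simp add: parcs_cube_iff)
    qed
  qed
qed

lemma cube_map_mor: "f \<in> square_mor n m \<Longrightarrow> cube_map m n f \<in> cube_mor m n"
  by (auto simp: cube_mor_iff PiE_def cube_map_verts cube_map_extensional cube_map_arc cube_map_map2)

section \<open>Bijectivity on hom-sets\<close>

lemma inj_on_cube_map: "inj_on (cube_map m n) (square_mor n m)"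
proof (rule inj_onI)
  fix f g
  assume f: "f \<in> square_mor n m" and g: "g \<in> square_mor n m"
    and eq: "cube_map m n f = cube_map m n g"
  have "f i = g i" if i: "i < n" for i
  proof (rule entry_inject)
    show "f i \<in> {..<m} <+> UNIV" "g i \<in> {..<m} <+> UNIV"
      using f g i by (auto simp: square_mor_def)
    show "entry x (f i) = entry x (g i)" if "x \<in> cube_verts m" for x
      using that i eq by (metis cube_map_nth)
  qed
  then show "f = g"
    using f g by (intro extensionalityI[of f "{..<n}"] square_mor_extensional) auto
qed

text \<open>Each output coordinate of \<open>g\<close> is a lattice homomorphism, hence a projection
  or a constant; these choices assemble into \<open>f\<close>. Arc preservation then supplies left
  injectivity.\<close>

lemma cube_mor_obtain_square_mor:
  assumes g: "g \<in> cube_mor m n"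
  obtains f where "f \<in> square_mor n m" "cube_map m n f = g"
proof -
  have gv: "g x \<in> cube_verts n" if "x \<in> cube_verts m" for x
    using g that by (auto simp: cube_mor_iff)
  have "\<exists>a \<in> {..<m} <+> UNIV. \<forall>x\<in>cube_verts m. g x ! i = entry x a" if i: "i < n" for i
  proof -
    have "(\<exists>k<m. \<forall>x\<in>cube_verts m. g x ! i = x ! k) \<or> (\<exists>b. \<forall>x\<in>cube_verts m. g x ! i = b)"
    proof (rule cube_hom_projection_or_constant)
      fix u v assume uv: "u \<in> cube_verts m" "v \<in> cube_verts m"
      then have "length (g u) = n" "length (g v) = n"
        using gv by (simp_all add: cube_verts_def)
      then show "g (map2 min u v) ! i = min (g u ! i) (g v ! i)"
        "g (map2 max u v) ! i = max (g u ! i) (g v ! i)"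
        using g uv i by (simp_all add: cube_mor_iff)
    qed
    then show ?thesis
    proof (elim disjE exE conjE)
      fix k assume "k < m" "\<forall>x\<in>cube_verts m. g x ! i = x ! k"
      then show ?thesis by (intro bexI[of _ "Inl k"]) auto
    next
      fix b assume "\<forall>x\<in>cube_verts m. g x ! i = b"
      then show ?thesis by (intro bexI[of _ "Inr b"]) auto
    qed
  qed
  then obtain f' where f': "\<And>i. i < n \<Longrightarrow> f' i \<in> {..<m} <+> UNIV"
    "\<And>i x. \<lbrakk>i < n; x \<in> cube_verts m\<rbrakk> \<Longrightarrow> g x ! i = entry x (f' i)"
    by metis
  define f where "f = restrict f' {..<n}"
  have "i = j" if ij: "i < n" "j < n" "f' i = Inl k" "f' j = Inl k" for i j k
  proof -
    \<comment> \<open>The arc from the zero vertex to the vertex with a single 1 at \<open>k\<close>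
      changes both output bits \<open>i\<close> and \<open>j\<close>, whereas an arc of the target
      changes at most one bit.\<close>
    let ?u = "replicate m False"
    let ?v = "?u[k := True]"
    have k: "k < m"
      using f'(1) ij by fastforce
    have u: "?u \<in> cube_verts m" and v: "?v \<in> cube_verts m"
      by (simp_all add: cube_verts_def)
    have "(?u, ?v) \<in> parcs (cube m)"
      using u k by (auto simp: parcs_cube_iff)
    then have "(g ?u, g ?v) \<in> parcs (cube n)"
      using g by (simp add: cube_mor_iff)
    moreover have "g ?v ! i" "g ?v ! j" "\<not> g ?u ! i" "\<not> g ?u ! j"
      using f'(2)[OF _ u] f'(2)[OF _ v] ij k by simp_all
    ultimately show ?thesis
      by (auto simp: parcs_cube_iff) (metis nth_list_update_neq)
  qed
  then have "f \<in> square_mor n m"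
    using f'(1) by (auto simp: f_def square_mor_def inj_on_left_def)
  moreover have "cube_map m n f = g"
  proof (rule extensionalityI[OF cube_map_extensional])
    show "g \<in> extensional (cube_verts m)"
      using g by (simp add: cube_mor_iff PiE_def)
    show "cube_map m n f x = g x" if "x \<in> cube_verts m" for x
      using that by (intro cube_verts_eqI[of _ n] cube_map_verts gv)
        (auto simp: cube_map_nth f_def f'(2))
  qed
  ultimately show ?thesis by (rule that)
qed

lemma bij_betw_cube_map: "bij_betw (cube_map m n) (square_mor n m) (cube_mor m n)"
  using inj_on_cube_map cube_map_mor
  by (auto intro!: bij_betw_imageI elim: cube_mor_obtain_square_mor)

section \<open>Functoriality and the isomorphism\<close>

lemma cube_map_ident: "cube_map n n (restrict Inl {..<n}) = restrict id (cube_verts n)"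
proof (rule extensionalityI[OF cube_map_extensional restrict_extensional])
  fix x assume "x \<in> cube_verts n"
  then show "cube_map n n (restrict Inl {..<n}) x = restrict id (cube_verts n) x"
    by (intro cube_verts_eqI[of _ n] cube_map_verts) (simp_all add: cube_map_nth)
qed

text \<open>This is associativity of composition with \<open>x\<close> as a morphism to
  \<open>0\<close>. The left values of \<open>g\<close> lie below \<open>n\<close>, where the
  coordinates of the image under \<open>f\<close> are known.\<close>

lemma cube_map_compose:
  assumes g: "g \<in> square_mor p n"
  shows "cube_map m p (compose {..<p} (case_sum f Inr) g) =
    compose (cube_verts m) (cube_map n p g) (cube_map m n f)"
proof (rule extensionalityI[OF cube_map_extensional compose_extensional])
  fix x assume x: "x \<in> cube_verts m"
  have "entry x (case_sum f Inr (g i)) = entry (cube_map m n f x) (g i)" if "i < p" for i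
    using g that by (cases rule: square_mor_cases) (simp_all add: x cube_map_nth)
  then show "cube_map m p (compose {..<p} (case_sum f Inr) g) x =
      compose (cube_verts m) (cube_map n p g) (cube_map m n f) x"
    using x by (intro cube_verts_eqI[of _ p])
      (simp_all add: compose_def cube_map_nth cube_map_verts)
qed

lemma cat_functor_cube_map: "cat_functor (opposite square_cat) cube_cat (\<lambda>n. n) cube_map"
proof -
  interpret S: category "opposite square_cat" by (intro category_opposite category_square)
  interpret G: category cube_cat by (rule category_cube)
  show ?thesis
    by unfold_locales
      (simp_all add: opposite_def square_cat_def cube_cat_def pverts_cube cube_map_mor
        cube_map_ident cube_map_compose)
qed

theorem theorem2p11:
  shows "\<exists>\<Phi> :: nat \<Rightarrow> nat \<Rightarrow> (nat \<Rightarrow> nat + bool) \<Rightarrow> (bool list \<Rightarrow> bool list).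
    cat_isomorphism (opposite square_cat) cube_cat (\<lambda>n. n) \<Phi> \<and>
    (\<forall>m n. bij_betw (\<Phi> m n) (Mor (opposite square_cat) m n) (Mor cube_cat m n)) \<and>
    (\<forall>n. \<Phi> n n (Ident (opposite square_cat) n) = Ident cube_cat n) \<and>
    (\<forall>m n p. \<forall>f \<in> Mor (opposite square_cat) m n. \<forall>g \<in> Mor (opposite square_cat) n p.
      \<Phi> m p (Cmp (opposite square_cat) m n p g f) = Cmp cube_cat m n p (\<Phi> n p g) (\<Phi> m n f))"
proof -
  interpret F: cat_functor "opposite square_cat" cube_cat "\<lambda>n. n" cube_map
    by (rule cat_functor_cube_map)
  \<comment> \<open>Every natural number is an object on both sides, so the functor laws hold for
    all indices.\<close>
  have ob: "Ob (opposite square_cat) = UNIV" "Ob cube_cat = UNIV"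
    by (simp_all add: opposite_def square_cat_def cube_cat_def)
  have bij: "bij_betw (cube_map m n) (Mor (opposite square_cat) m n) (Mor cube_cat m n)" for m n
    using bij_betw_cube_map by (simp add: opposite_def square_cat_def cube_cat_def)
  have "cat_isomorphism (opposite square_cat) cube_cat (\<lambda>n. n) cube_map"
    using cat_functor_cube_map by (rule cat_isomorphism_identity_on_objects) (simp_all add: ob bij)
  then show ?thesis
    using bij F.fun_ident F.fun_cmp by (intro exI[of _ cube_map]) (simp add: ob)
qed

end
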